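(* Let $\mathsf h_4(\psi,\bar\psi)=\int_I\psi\,\bar\psi\,dy$ and $$\mathsf F_4(\psi,\bar\psi)=\int_I\left(\frac{(\psi+\bar\psi)\,[-\partial_{y_1}^2(\psi+\bar\psi)]}{4}+\beta\frac{(\psi+\bar\psi)^4}{16}\right)dy,$$ and let $\langle\mathsf F_4\rangle$ be the average of $\mathsf F_4$ along the flow of $\mathsf h_4$. Then the equations of motion associated to the Hamiltonian $\mathsf h_4(\psi,\bar\psi)+\mu^2\langle\mathsf F_4\rangle(\psi,\bar\psi)$ are given by a cubic one-dimensional nonlinear Schrödinger equation for each fixed value of $y_2$, $$-i\psi_\tau=\psi-\mu^2\,\partial_{y_1}^2\psi+\mu^2\,\frac{3\beta}{4}\,|\psi|^2\psi .$$
   Context: $I=[-1,1]^2$ with coordinates $y=(y_1,y_2)$; $\psi=\psi(\tau,y)$ is a (sufficiently regular) complex-valued function, 2-periodic in $y_1$ and in $y_2$; $\beta>0$ and $\mu>0$ (small) are parameters. The variable $\psi=\frac{1}{\sqrt2}(q-ip)$ is built from real canonically conjugated variables $(q,p)$, and the symplectic form is $-i\,d\psi\wedge d\bar\psi$. The Hamiltonian $\mathsf h_4$ generates the equation $-i\,\partial_\tau\psi=\psi$, whose flow $\Phi^\tau\psi=e^{i\tau}\psi$ is periodic of period $T=2\pi$, and the average is $\langle\mathsf F_4\rangle(\psi,\bar\psi)=\frac1T\int_0^T\mathsf F_4(\Phi^\tau\psi,\overline{\Phi^\tau\psi})\,d\tau$. The paper gives this average as $\langle\mathsf F_4\rangl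e(\psi,\bar\psi)=\int_I\frac{\bar\psi\,(-\partial_{y_1}^2\psi)}{2}\,dy+\frac{3\beta}{8}\int_I|\psi|^4\,dy$.
   Formalization: The coefficient of -∂_{y_1}^2 ψ is μ²/2 instead of the displayed μ²: the average contains ψ̄(-∂_{y_1}^2 ψ)/2, so its derivative in ψ̄ keeps the factor 1/2; plane waves A e^{iωτ} e^{iπ y_1} show that the displayed equation fails. *)

theory Defs
  imports "HOL-Analysis.Analysis"
begin

definition cell :: "(real \<times> real) set"
  where "cell = cbox (-1, -1) (1, 1)"

definition dy1 :: "(real \<times> real \<Rightarrow> complex) \<Rightarrow> real \<times> real \<Rightarrow> complex"
  where "dy1 u = (\<lambda>(y1, y2). vector_derivative (\<lambda>s. u (s, y2)) (at y1))"

text \<open>States are functions on the whole plane, 2-periodic in both variables. Only the regularity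
  needed to write down the functionals below is required; in particular no differentiability in the
  second variable.\<close>

definition phase_space :: "(real \<times> real \<Rightarrow> complex) set"
  where "phase_space = {u.
    (\<forall>y1 y2. u (y1 + 2, y2) = u (y1, y2) \<and> u (y1, y2 + 2) = u (y1, y2)) \<and>
    (\<forall>y1 y2. (\<lambda>s. u (s, y2)) differentiable (at y1)) \<and>
    (\<forall>y1 y2. (\<lambda>s. dy1 u (s, y2)) differentiable (at y1)) \<and>
    continuous_on UNIV u \<and> continuous_on UNIV (dy1 u) \<and> continuous_on UNIV (dy1 (dy1 u))}"

text \<open>A functional \<open>F(\<psi>, cnj \<psi>)\<close> of a state and its conjugate is rendered as a function of
  the state alone; the values of the functionals below are real numbers, embedded in the complex
  numbers.\<close>

definition h4 :: "(real \<times> real \<Rightarrow> complex) \<Rightarrow> complex"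
  where "h4 u = integral cell (\<lambda>y. u y * cnj (u y))"

definition F4 :: "real \<Rightarrow> (real \<times> real \<Rightarrow> complex) \<Rightarrow> complex"
  where "F4 \<beta> u = integral cell (\<lambda>y.
    (u y + cnj (u y)) * (- dy1 (dy1 (\<lambda>z. u z + cnj (u z))) y) / 4
    + of_real \<beta> * (u y + cnj (u y)) ^ 4 / 16)"

definition flow :: "real \<Rightarrow> (real \<times> real \<Rightarrow> complex) \<Rightarrow> real \<times> real \<Rightarrow> complex"
  where "flow \<tau> u = (\<lambda>y. exp (\<i> * of_real \<tau>) * u y)"

definition flow_average ::
    "((real \<times> real \<Rightarrow> complex) \<Rightarrow> complex) \<Rightarrow> (real \<times> real \<Rightarrow> complex) \<Rightarrow> complex"
  where "flow_average F u = 1 / of_real (2 * pi) * integral {0..2 * pi} (\<lambda>\<tau>. F (flow \<tau> u))"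

text \<open>The symplectic form \<open>- i d\<psi> \<and> d(cnj \<psi>)\<close>, with the convention
  \<open>(\<alpha> \<and> \<beta>)(X, Y) = \<alpha>(X) \<beta>(Y) - \<alpha>(Y) \<beta>(X)\<close>, integrated over the cell.\<close>

definition sympl ::
    "(real \<times> real \<Rightarrow> complex) \<Rightarrow> (real \<times> real \<Rightarrow> complex) \<Rightarrow> complex"
  where "sympl X Y = integral cell (\<lambda>y. - \<i> * (X y * cnj (Y y) - Y y * cnj (X y)))"

definition time_deriv ::
    "(real \<Rightarrow> real \<times> real \<Rightarrow> complex) \<Rightarrow> real \<Rightarrow> real \<times> real \<Rightarrow> complex"
  where "time_deriv \<psi> \<tau> = (\<lambda>y. vector_derivative (\<lambda>t. \<psi> t y) (at \<tau>))"

definition regular_trajectory :: "real set \<Rightarrow> (real \<Rightarrow> real \<times> real \<Rightarrow> complex) \<Rightarrow> bool"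
  where "regular_trajectory J \<psi> \<longleftrightarrow> (\<forall>\<tau>\<in>J. \<psi> \<tau> \<in> phase_space \<and>
    (\<forall>y. (\<lambda>t. \<psi> t y) differentiable (at \<tau>)) \<and> continuous_on UNIV (time_deriv \<psi> \<tau>))"

text \<open>Hamilton's equations in the form \<open>dH(\<psi>)[v] = \<omega>(\<psi>\<^sub>\<tau>, v)\<close> for all variations \<open>v\<close>. The sign
  convention is the one for which \<open>h4\<close> generates \<open>- i \<psi>\<^sub>\<tau> = \<psi>\<close>, as checked below.\<close>

definition hamiltonian_motion ::
    "((real \<times> real \<Rightarrow> complex) \<Rightarrow> complex) \<Rightarrow> real set
      \<Rightarrow> (real \<Rightarrow> real \<times> real \<Rightarrow> complex) \<Rightarrow> bool"
  where "hamiltonian_motion H J \<psi> \<longleftrightarrow> (\<forall>\<tau>\<in>J. \<forall>v\<in>phase_space.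
    ((\<lambda>s. H (\<lambda>y. \<psi> \<tau> y + of_real s * v y))
      has_vector_derivative sympl (time_deriv \<psi> \<tau>) v) (at 0))"

lemma flow_hamiltonian_motion:
  assumes "u \<in> phase_space"
  shows "hamiltonian_motion h4 UNIV (\<lambda>\<tau>. flow \<tau> u)"
  unfolding hamiltonian_motion_def
proof (intro ballI)
  fix \<tau> :: real and v assume v: "v \<in> phase_space"
  define w where "w = flow \<tau> u"
  have cu: "continuous_on UNIV u" and cv: "continuous_on UNIV v"
    using assms v by (auto simp: phase_space_def)
  have cw: "continuous_on UNIV w"
    unfolding w_def flow_def by (intro continuous_intros cu)
  have c: "continuous_on cell w" "continuous_on cell v"
    using cw cv continuous_on_subset by blast+
  have int: "f integrable_on cell" if "continuous_on cell f" for f :: "real \<times> real \<Rightarrow> complex"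
    using that unfolding cell_def by (rule integrable_continuous)
  have td: "time_deriv (\<lambda>\<tau>. flow \<tau> u) \<tau> = (\<lambda>y. \<i> * w y)"
  proof
    fix y
    have "((\<lambda>t. exp (\<i> * of_real t) * u y) has_vector_derivative \<i> * w y) (at \<tau>)"
      unfolding w_def flow_def
      by (auto intro!: derivative_eq_intros has_vector_derivative_real_field)
    then show "time_deriv (\<lambda>\<tau>. flow \<tau> u) \<tau> y = \<i> * w y"
      unfolding time_deriv_def flow_def by (rule vector_derivative_at)
  qed
  define A where "A = integral cell (\<lambda>y. w y * cnj (w y))"
  define B where "B = integral cell (\<lambda>y. w y * cnj (v y) + v y * cnj (w y))"
  define C where "C = integral cell (\<lambda>y. v y * cnj (v y))"
  have "h4 (\<lambda>y. w y + of_real s * v y) = A + of_real s * B + of_real s ^ 2 * C" for s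
  proof -
    have "h4 (\<lambda>y. w y + of_real s * v y) = integral cell (\<lambda>y. w y * cnj (w y) +
        of_real s * (w y * cnj (v y) + v y * cnj (w y)) + of_real s ^ 2 * (v y * cnj (v y)))"
      unfolding h4_def by (rule arg_cong[of _ _ "integral cell"])
        (auto simp: algebra_simps power2_eq_square)
    also have "\<dots> = A + of_real s * B + of_real s ^ 2 * C"
      unfolding A_def B_def C_def
      by (subst integral_add; (subst integral_add)?; (intro int continuous_intros c)?) auto
    finally show ?thesis .
  qed
  moreover have "((\<lambda>s. A + of_real s * B + of_real s ^ 2 * C) has_vector_derivative B) (at 0)"
    by (rule has_vector_derivative_real_field) (auto intro!: derivative_eq_intros)
  moreover have "sympl (\<lambda>y. \<i> * w y) v = B"
    unfolding sympl_def B_def by (rule arg_cong[of _ _ "integral cell"]) (auto simp: algebra_simps)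
  ultimately show "((\<lambda>s. h4 (\<lambda>y. flow \<tau> u y + of_real s * v y)) has_vector_derivative
      sympl (time_deriv (\<lambda>\<tau>. flow \<tau> u) \<tau>) v) (at 0)"
    by (simp add: td w_def)
qed

text \<open>The cubic NLS in one space dimension with dispersion coefficient \<open>a\<close> and nonlinear
  coefficient \<open>b\<close>. For the averaged Hamiltonian \<open>a = \<mu>\<^sup>2/2\<close>: its quadratic part is the integral
  of \<open>cnj \<psi> * (- \<psi>\<^sub>y\<^sub>1\<^sub>y\<^sub>1) / 2\<close>, whose derivative with respect to \<open>cnj \<psi>\<close> keeps the factor
  \<open>1/2\<close>. The published formula has \<open>a = \<mu>\<^sup>2\<close>, which is inconsistent with that Hamiltonian and the
  symplectic form above.\<close>

definition solves_cubic_nls :: "real \<Rightarrow> real \<Rightarrow> real set \<Rightarrow> (real \<Rightarrow> real \<Rightarrow> complex) \<Rightarrow> bool"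
  where "solves_cubic_nls a b J w \<longleftrightarrow> (\<forall>\<tau>\<in>J. \<forall>x.
    - \<i> * vector_derivative (\<lambda>t. w t x) (at \<tau>) =
      w \<tau> x
      - of_real a * vector_derivative (\<lambda>s. vector_derivative (w \<tau>) (at s)) (at x)
      + of_real b * of_real ((cmod (w \<tau> x))\<^sup>2) * w \<tau> x)"

end

theory Submission
  imports Defs
begin

text \<open>Along the flow of \<open>h4\<close> the functional \<open>F4\<close> is a trigonometric polynomial in \<open>\<tau>\<close> with
  frequencies \<open>0\<close>, \<open>\<plusminus>2\<close>, \<open>\<plusminus>4\<close>, and averaging keeps the coefficient of frequency \<open>0\<close>. The averaged
  Hamiltonian is then a quartic polynomial in \<open>s\<close> along \<open>\<psi> + s v\<close>; integrating by parts in \<open>y\<^sub>1\<close>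
  its linear coefficient becomes the integral of \<open>G * cnj v + v * cnj G\<close>, with \<open>G\<close> the right-hand
  side of the Schroedinger equation. Hamilton's equations thus say that \<open>G + \<i> \<psi>\<^sub>\<tau>\<close> is orthogonal to
  every state, and since the states contain periodic bump functions concentrated near any given
  point, this forces it to vanish pointwise.\<close>

section \<open>Derivatives and periodicity of states in the first variable\<close>

lemma dy1_apply: "dy1 u (y1, y2) = vector_derivative (\<lambda>s. u (s, y2)) (at y1)"
  by (simp add: dy1_def)

lemma phase_space_deriv:
  assumes "u \<in> phase_space"
  shows "((\<lambda>s. u (s, y2)) has_vector_derivative dy1 u (y1, y2)) (at y1)"
    and "((\<lambda>s. dy1 u (s, y2)) has_vector_derivative dy1 (dy1 u) (y1, y2)) (at y1)"
proof -
  have "(\<lambda>s. u (s, y2)) differentiable (at y1)" "(\<lambda>s. dy1 u (s, y2)) differentiable (at y1)"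
    using assms by (simp_all add: phase_space_def)
  then show "((\<lambda>s. u (s, y2)) has_vector_derivative dy1 u (y1, y2)) (at y1)"
    "((\<lambda>s. dy1 u (s, y2)) has_vector_derivative dy1 (dy1 u) (y1, y2)) (at y1)"
    by (simp_all only: vector_derivative_works dy1_apply)
qed

lemma phase_space_continuous:
  assumes "u \<in> phase_space"
  shows "continuous_on A u" "continuous_on A (dy1 u)" "continuous_on A (dy1 (dy1 u))"
  using assms continuous_on_subset[OF _ subset_UNIV] by (auto simp: phase_space_def)

lemma phase_space_periodic:
  assumes "u \<in> phase_space"
  shows "u (y1 + 2, y2) = u (y1, y2)" "u (y1, y2 + 2) = u (y1, y2)"
  using assms by (auto simp: phase_space_def)

lemma dy1_eqI:
  assumes "\<And>y1 y2. ((\<lambda>s. u (s, y2)) has_vector_derivative d (y1, y2)) (at y1)"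
  shows "dy1 u = d"
  unfolding dy1_def by (rule ext) (simp add: split_beta vector_derivative_at[OF assms])

text \<open>Translating the argument by a period does not change the function, so by the chain rule
  and uniqueness of derivatives it does not change the derivative. With \<open>d\<close> arbitrary,
  the lemma serves for \<open>dy1 u\<close> and again for \<open>dy1 (dy1 u)\<close>.\<close>

lemma dy1_periodic:
  assumes "\<And>y1 y2. u (y1 + 2, y2) = u (y1, y2) \<and> u (y1, y2 + 2) = u (y1, y2)"
    and "\<And>y1 y2. ((\<lambda>s. u (s, y2)) has_vector_derivative d (y1, y2)) (at y1)"
  shows "d (y1 + 2, y2) = d (y1, y2)" "d (y1, y2 + 2) = d (y1, y2)"
proof -
  have "((\<lambda>s. u (s, y2)) \<circ> (\<lambda>s. s + 2) has_vector_derivative 1 *\<^sub>R d (y1 + 2, y2)) (at y1)"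
    using assms(2)[of y2 "y1 + 2"]
    by (intro vector_diff_chain_at) (auto intro!: derivative_eq_intros simp: has_vector_derivative_def has_derivative_def)
  then have "((\<lambda>s. u (s, y2)) has_vector_derivative d (y1 + 2, y2)) (at y1)"
    using assms(1) by (simp add: o_def)
  then show "d (y1 + 2, y2) = d (y1, y2)"
    using assms(2) vector_derivative_unique_at by blast
  have "((\<lambda>s. u (s, y2)) has_vector_derivative d (y1, y2 + 2)) (at y1)"
    using assms(2)[of "y2 + 2" y1] by (simp add: assms(1))
  then show "d (y1, y2 + 2) = d (y1, y2)"
    using assms(2) vector_derivative_unique_at by blast
qed

lemma phase_space_dy1_periodic:
  assumes "u \<in> phase_space"
  shows "dy1 u (y1 + 2, y2) = dy1 u (y1, y2)" "dy1 u (y1, y2 + 2) = dy1 u (y1, y2)"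
    and "dy1 (dy1 u) (y1 + 2, y2) = dy1 (dy1 u) (y1, y2)"
    and "dy1 (dy1 u) (y1, y2 + 2) = dy1 (dy1 u) (y1, y2)"
proof -
  have 1: "dy1 u (y1 + 2, y2) = dy1 u (y1, y2) \<and> dy1 u (y1, y2 + 2) = dy1 u (y1, y2)" for y1 y2
    using dy1_periodic[of u "dy1 u"] phase_space_periodic[OF assms] phase_space_deriv(1)[OF assms]
    by blast
  then show "dy1 u (y1 + 2, y2) = dy1 u (y1, y2)" "dy1 u (y1, y2 + 2) = dy1 u (y1, y2)"
    by simp_all
  show "dy1 (dy1 u) (y1 + 2, y2) = dy1 (dy1 u) (y1, y2)"
    "dy1 (dy1 u) (y1, y2 + 2) = dy1 (dy1 u) (y1, y2)"
    using dy1_periodic[of "dy1 u" "dy1 (dy1 u)"] 1 phase_space_deriv(2)[OF assms] by blast+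
qed

text \<open>Candidates \<open>d\<close> and \<open>e\<close> for the two derivatives are supplied
  explicitly, so that membership and the value of the second derivative come out together and
  \<open>vector_derivative\<close> never has to be computed.\<close>

lemma phase_spaceI:
  assumes "\<And>y1 y2. u (y1 + 2, y2) = u (y1, y2) \<and> u (y1, y2 + 2) = u (y1, y2)"
    and "\<And>y1 y2. ((\<lambda>s. u (s, y2)) has_vector_derivative d (y1, y2)) (at y1)"
    and "\<And>y1 y2. ((\<lambda>s. d (s, y2)) has_vector_derivative e (y1, y2)) (at y1)"
    and "continuous_on UNIV u" "continuous_on UNIV d" "continuous_on UNIV e"
  shows "u \<in> phase_space \<and> dy1 (dy1 u) = e"
proof -
  have du: "dy1 u = d" and dd: "dy1 d = e"
    using assms(2,3) by (auto intro: dy1_eqI)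
  have "u \<in> phase_space"
    using assms(1,4-6) unfolding phase_space_def mem_Collect_eq du dd
    by (intro conjI allI differentiableI_vector[OF assms(2)] differentiableI_vector[OF assms(3)]) auto
  then show ?thesis by (simp add: du dd)
qed

text \<open>Used with coefficients \<open>1\<close>, \<open>s\<close> for a state moved along a
  variation, and with \<open>a\<close>, \<open>cnj a\<close> for the real field built from a state
  rotated by the flow.\<close>

lemma phase_space_lincomb:
  assumes u: "u \<in> phase_space" and v: "v \<in> phase_space"
  shows "(\<lambda>y. a * u y + b * v y) \<in> phase_space \<and>
    dy1 (dy1 (\<lambda>y. a * u y + b * v y)) = (\<lambda>y. a * dy1 (dy1 u) y + b * dy1 (dy1 v) y)"
proof (rule phase_spaceI[where d = "\<lambda>y. a * dy1 u y + b * dy1 v y"])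
  fix y1 y2
  show "((\<lambda>s. a * u (s, y2) + b * v (s, y2)) has_vector_derivative
      a * dy1 u (y1, y2) + b * dy1 v (y1, y2)) (at y1)"
    by (intro has_vector_derivative_add has_vector_derivative_mult_right phase_space_deriv u v)
  show "((\<lambda>s. a * dy1 u (s, y2) + b * dy1 v (s, y2)) has_vector_derivative
      a * dy1 (dy1 u) (y1, y2) + b * dy1 (dy1 v) (y1, y2)) (at y1)"
    by (intro has_vector_derivative_add has_vector_derivative_mult_right phase_space_deriv u v)
qed (intro continuous_intros phase_space_continuous u v | simp add: phase_space_periodic u v)+

lemma phase_space_cnj:
  assumes u: "u \<in> phase_space"
  shows "(\<lambda>y. cnj (u y)) \<in> phase_space \<and>
    dy1 (dy1 (\<lambda>y. cnj (u y))) = (\<lambda>y. cnj (dy1 (dy1 u) y))"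
proof (rule phase_spaceI[where d = "\<lambda>y. cnj (dy1 u y)"])
qed (intro continuous_intros has_vector_derivative_cnj phase_space_continuous phase_space_deriv u
  | simp add: phase_space_periodic u)+

section \<open>Integration by parts over the cell\<close>

lemma integrable_cell:
  fixes f :: "real \<times> real \<Rightarrow> complex"
  assumes "continuous_on UNIV f"
  shows "f integrable_on cell"
  unfolding cell_def by (rule integrable_continuous) (rule continuous_on_subset[OF assms subset_UNIV])

text \<open>Fubini makes the integral in the first variable the inner one, where the fundamental
  theorem of calculus leaves only boundary values, and these cancel.\<close>

lemma integral_cell_dy1_eq_0:
  fixes W f :: "real \<times> real \<Rightarrow> complex"
  assumes f: "continuous_on UNIV f"
    and W: "\<And>y1 y2. ((\<lambda>s. W (s, y2)) has_vector_derivative f (y1, y2)) (at y1)"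
    and per: "\<And>y2. W (1, y2) = W (-1, y2)"
  shows "integral cell f = 0"
proof -
  have c: "continuous_on (cbox (-1, -1) (1, 1)) (\<lambda>(x, y). f (x, y))"
    using continuous_on_subset[OF f subset_UNIV] by simp
  have 0: "integral (cbox (-1) 1) (\<lambda>x. f (x, y)) = 0" for y
  proof -
    have "((\<lambda>x. f (x, y)) has_integral W (1, y) - W (-1, y)) {-1..1}"
      by (rule fundamental_theorem_of_calculus) (auto intro: has_vector_derivative_at_within W)
    then show ?thesis
      by (simp add: per integral_unique)
  qed
  have "integral cell f = integral (cbox (-1) 1) (\<lambda>x. integral (cbox (-1) 1) (\<lambda>y. f (x, y)))"
    unfolding cell_def by (rule integral_prod_continuous) (use c in simp)
  also have "\<dots> = integral (cbox (-1) 1) (\<lambda>y. integral (cbox (-1) 1) (\<lambda>x. f (x, y)))"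
    by (rule integral_swap_continuous[OF c])
  finally show ?thesis by (simp only: 0 integral_0)
qed

text \<open>The difference of the two integrands is the derivative of the Wronskian
  \<open>u * dy1 v - dy1 u * v\<close>, since the products of first derivatives cancel. This
  replaces two successive integrations by parts.\<close>

lemma dy1_dy1_symmetric:
  assumes u: "u \<in> phase_space" and v: "v \<in> phase_space"
  shows "integral cell (\<lambda>y. u y * dy1 (dy1 v) y) = integral cell (\<lambda>y. dy1 (dy1 u) y * v y)"
proof -
  note c = phase_space_continuous[OF u] phase_space_continuous[OF v]
  have "integral cell (\<lambda>y. u y * dy1 (dy1 v) y - dy1 (dy1 u) y * v y) = 0"
  proof (rule integral_cell_dy1_eq_0[where W = "\<lambda>y. u y * dy1 v y - dy1 u y * v y"])
    fix y1 y2
    show "((\<lambda>s. u (s, y2) * dy1 v (s, y2) - dy1 u (s, y2) * v (s, y2)) has_vector_derivative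
        u (y1, y2) * dy1 (dy1 v) (y1, y2) - dy1 (dy1 u) (y1, y2) * v (y1, y2)) (at y1)"
      using has_vector_derivative_diff[OF
          has_vector_derivative_mult[OF phase_space_deriv(1)[OF u, of y2] phase_space_deriv(2)[OF v, of y2]]
          has_vector_derivative_mult[OF phase_space_deriv(2)[OF u, of y2] phase_space_deriv(1)[OF v, of y2]]]
      by (simp add: algebra_simps)
    \<comment> \<open>The two vertical edges of the cell are exactly one period apart: 1 = -1 +
      2.\<close>
    have "w (1, y2) = w (-1, y2) \<and> dy1 w (1, y2) = dy1 w (-1, y2)" if w: "w \<in> phase_space" for w
      using phase_space_periodic[OF w, of "-1" y2]
        phase_space_dy1_periodic(1)[OF w, of "-1" y2]
      by simp
    then show "u (1, y2) * dy1 v (1, y2) - dy1 u (1, y2) * v (1, y2) =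
        u (-1, y2) * dy1 v (-1, y2) - dy1 u (-1, y2) * v (-1, y2)"
      using u v by metis
  qed (intro continuous_intros c)
  then show ?thesis
    by (subst (asm) integral_diff) (auto intro!: integrable_cell continuous_intros c)
qed

section \<open>Averaging \<open>F4\<close> along the flow of \<open>h4\<close>\<close>

text \<open>The antiderivative \<open>exp (c * t) / c\<close> takes the same value at 0 and at
  \<open>2 * pi\<close>, because \<open>k\<close> is an integer.\<close>

lemma has_integral_exp_frequency:
  fixes k :: int
  assumes "k \<noteq> 0"
  shows "((\<lambda>\<tau>. exp (\<i> * of_int k * of_real \<tau>)) has_integral 0) {0..2 * pi}"
proof -
  define c where "c = \<i> * (of_int k :: complex)"
  have c: "c \<noteq> 0" using assms by (simp add: c_def)
  have "((\<lambda>\<tau>. exp (c * of_real \<tau>)) has_integral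
      exp (c * of_real (2 * pi)) / c - exp (c * of_real 0) / c) {0..2 * pi}"
  proof (rule fundamental_theorem_of_calculus)
    fix x :: real
    have "((\<lambda>z. exp (c * z) / c) has_field_derivative exp (c * of_real x)) (at (of_real x))"
      using c by (auto intro!: derivative_eq_intros)
    then show "((\<lambda>\<tau>. exp (c * of_real \<tau>) / c) has_vector_derivative exp (c * of_real x))
        (at x within {0..2 * pi})"
      by (rule has_vector_derivative_at_within[OF
            has_vector_derivative_real_field[where f = "\<lambda>z. exp (c * z) / c"]])
  qed simp
  moreover have "exp (c * of_real (2 * pi)) = 1"
    using exp_integer_2pi[of "of_int k"] by (simp add: c_def mult_ac)
  ultimately show ?thesis by (simp add: c_def)
qed

text \<open>A monomial with m factors from the rotated state and n from its conjugate rotates with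
  frequency m - n. Frequency 0 in the quartic term comes from the middle binomial coefficient, 6/16
  = 3/8; frequencies 2 and -2 carry 4/16 = 1/4, and 4 and -4 carry 1/16.\<close>

lemma F4_flow:
  assumes u: "u \<in> phase_space"
  defines "D \<equiv> dy1 (dy1 u)" and "e \<equiv> \<lambda>k::int. \<lambda>\<tau>::real. exp (\<i> * of_int k * of_real \<tau>)"
  shows "F4 \<beta> (flow \<tau> u) =
    integral cell (\<lambda>y. - (u y * cnj (D y) + cnj (u y) * D y) / 4 + of_real (3 * \<beta> / 8) * (u y * cnj (u y)) ^ 2)
    + e 2 \<tau> * integral cell (\<lambda>y. - (u y * D y) / 4 + of_real (\<beta> / 4) * (u y ^ 3 * cnj (u y)))
    + e (- 2) \<tau> * integral cell (\<lambda>y. - (cnj (u y) * cnj (D y)) / 4 + of_real (\<beta> / 4) * (u y * cnj (u y) ^ 3))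
    + e 4 \<tau> * integral cell (\<lambda>y. of_real (\<beta> / 16) * u y ^ 4)
    + e (- 4) \<tau> * integral cell (\<lambda>y. of_real (\<beta> / 16) * cnj (u y) ^ 4)"
    (is "_ = integral cell ?c0 + _ * integral cell ?c2 + _ * integral cell ?d2
      + _ * integral cell ?c4 + _ * integral cell ?d4")
proof -
  note c = phase_space_continuous[OF u]
  define a where "a = exp (\<i> * of_real \<tau>)"
  have ca: "cnj a = exp (- (\<i> * of_real \<tau>))" by (simp add: a_def exp_cnj)
  have aa: "a * cnj a = 1" unfolding ca by (simp add: a_def exp_minus)
  have ea: "e 2 \<tau> = a ^ 2" "e 4 \<tau> = a ^ 4" "e (- 2) \<tau> = cnj a ^ 2" "e (- 4) \<tau> = cnj a ^ 4"
    unfolding ca unfolding e_def a_def by (simp_all flip: exp_of_nat_mult add: mult_ac)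
  have dd: "dy1 (dy1 (\<lambda>z. a * u z + cnj (a * u z))) = (\<lambda>y. a * D y + cnj a * cnj (D y))"
    using phase_space_lincomb[OF u conjunct1[OF phase_space_cnj[OF u]], of a "cnj a"]
      phase_space_cnj[OF u] by (simp add: D_def)
  have "F4 \<beta> (flow \<tau> u) = integral cell (\<lambda>y. ?c0 y + e 2 \<tau> * ?c2 y + e (- 2) \<tau> * ?d2 y
      + e 4 \<tau> * ?c4 y + e (- 4) \<tau> * ?d4 y)"
    unfolding F4_def flow_def a_def[symmetric] dd
  proof (rule arg_cong[of _ _ "integral cell"], rule ext)
    fix y
    define p q P Q where "p = a * u y" and "q = cnj a * cnj (u y)"
      and "P = a * D y" and "Q = cnj a * cnj (D y)"
    \<comment> \<open>Pairing a rotated factor with a conjugate one removes the phase, as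
      \<open>a * cnj a = 1\<close>; these products form the part constant in time.\<close>
    have "p * q = u y * cnj (u y) * (a * cnj a)" "p * Q = u y * cnj (D y) * (a * cnj a)"
        "q * P = cnj (u y) * D y * (a * cnj a)"
      by (simp_all add: p_def q_def P_def Q_def)
    then have pq: "p * q = u y * cnj (u y)" "p * Q = u y * cnj (D y)" "q * P = cnj (u y) * D y"
      by (simp_all add: aa)
    have "(a * u y + cnj (a * u y)) * - (a * D y + cnj a * cnj (D y)) / 4
        + of_real \<beta> * (a * u y + cnj (a * u y)) ^ 4 / 16
      = (p + q) * - (P + Q) / 4 + of_real \<beta> * (p + q) ^ 4 / 16"
      by (simp add: p_def q_def P_def Q_def)
    also have "\<dots> = - (p * Q + q * P) / 4 + of_real (3 * \<beta> / 8) * (p * q) ^ 2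
      + (- (p * P) / 4 + of_real (\<beta> / 4) * p ^ 2 * (p * q))
      + (- (q * Q) / 4 + of_real (\<beta> / 4) * q ^ 2 * (p * q))
      + of_real (\<beta> / 16) * p ^ 4 + of_real (\<beta> / 16) * q ^ 4"
      by (simp add: field_simps power2_eq_square power4_eq_xxxx)
    also have "\<dots> = ?c0 y + e 2 \<tau> * ?c2 y + e (- 2) \<tau> * ?d2 y + e 4 \<tau> * ?c4 y + e (- 4) \<tau> * ?d4 y"
      unfolding pq ea unfolding p_def q_def P_def Q_def
      by (simp add: field_simps power2_eq_square power3_eq_cube power4_eq_xxxx)
    finally show "(a * u y + cnj (a * u y)) * - (a * D y + cnj a * cnj (D y)) / 4
        + of_real \<beta> * (a * u y + cnj (a * u y)) ^ 4 / 16 =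
      ?c0 y + e 2 \<tau> * ?c2 y + e (- 2) \<tau> * ?d2 y + e 4 \<tau> * ?c4 y + e (- 4) \<tau> * ?d4 y" .
  qed
  also have "\<dots> = integral cell ?c0 + e 2 \<tau> * integral cell ?c2 + e (- 2) \<tau> * integral cell ?d2
      + e 4 \<tau> * integral cell ?c4 + e (- 4) \<tau> * integral cell ?d4"
    unfolding D_def
    by (intro integral_unique has_integral_add has_integral_mult_right integrable_integral
        integrable_cell continuous_intros c) simp_all
  finally show ?thesis .
qed

text \<open>The quadratic part is left symmetric in the state and its conjugate. By
  \<open>dy1_dy1_symmetric\<close> it has the same integral as
  \<open>cnj u * (- dy1 (dy1 u)) / 2\<close>.\<close>

lemma flow_average_F4:
  assumes u: "u \<in> phase_space"
  shows "flow_average (F4 \<beta>) u = integral cell (\<lambda>y.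
    - (u y * cnj (dy1 (dy1 u) y) + cnj (u y) * dy1 (dy1 u) y) / 4
    + of_real (3 * \<beta> / 8) * (u y * cnj (u y)) ^ 2)" (is "_ = ?A")
proof -
  have z: "((\<lambda>\<tau>. exp (\<i> * of_int k * of_real \<tau>) * z) has_integral 0) {0..2 * pi}"
    if "k \<noteq> 0" for k :: int and z
    using has_integral_mult_left[OF has_integral_exp_frequency[OF that], of z] by simp
  have "((\<lambda>\<tau>. F4 \<beta> (flow \<tau> u)) has_integral (2 * pi) *\<^sub>R ?A + 0 + 0 + 0 + 0) {0..2 * pi}"
    unfolding F4_flow[OF u]
    by (intro has_integral_add z) (use has_integral_const_real[of ?A 0 "2 * pi"] in simp_all)
  then show ?thesis
    by (simp add: flow_average_def integral_unique scaleR_conv_of_real)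
qed

section \<open>Variation of the averaged Hamiltonian\<close>

text \<open>Linearity moves the powers of \<open>s\<close> out of the integral, leaving a polynomial
  with constant coefficients, so the question of differentiating under the integral sign does not
  arise.\<close>

lemma integral_cell_quartic_has_derivative:
  fixes p0 p1 p2 p3 p4 :: "real \<times> real \<Rightarrow> complex"
  assumes c: "continuous_on UNIV p0" "continuous_on UNIV p1" "continuous_on UNIV p2"
    "continuous_on UNIV p3" "continuous_on UNIV p4"
  shows "((\<lambda>s. integral cell (\<lambda>y. p0 y + of_real s * p1 y + of_real s ^ 2 * p2 y
    + of_real s ^ 3 * p3 y + of_real s ^ 4 * p4 y)) has_vector_derivative integral cell p1) (at 0)"
proof -
  have "integral cell (\<lambda>y. p0 y + of_real s * p1 y + of_real s ^ 2 * p2 y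
      + of_real s ^ 3 * p3 y + of_real s ^ 4 * p4 y) = integral cell p0 + of_real s * integral cell p1
      + of_real s ^ 2 * integral cell p2 + of_real s ^ 3 * integral cell p3 + of_real s ^ 4 * integral cell p4"
    for s :: real
    by (intro integral_unique has_integral_add has_integral_mult_right integrable_integral
        integrable_cell c)
  moreover have "((\<lambda>s. integral cell p0 + of_real s * integral cell p1
      + of_real s ^ 2 * integral cell p2 + of_real s ^ 3 * integral cell p3 + of_real s ^ 4 * integral cell p4)
      has_vector_derivative integral cell p1) (at 0)"
    by (rule has_vector_derivative_real_field) (auto intro!: derivative_eq_intros)
  ultimately show ?thesis by simp
qed

definition nls_field :: "real \<Rightarrow> real \<Rightarrow> (real \<times> real \<Rightarrow> complex) \<Rightarrow> real \<times> real \<Rightarrow> complex"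
  where "nls_field a b u y = u y - of_real a * dy1 (dy1 u) y + of_real b * (u y * cnj (u y)) * u y"

lemma continuous_nls_field:
  assumes "u \<in> phase_space"
  shows "continuous_on A (nls_field a b u)"
  unfolding nls_field_def by (intro continuous_intros phase_space_continuous assms)

text \<open>Varying the quadratic part gives terms of weight 1/4 with the derivatives on
  \<open>u\<close> and as many with the derivatives on \<open>v\<close>. Moving the latter onto
  \<open>u\<close> doubles the former, whence \<mu>^2/2. In the quartic part, the square doubles 3/8
  to 3/4.\<close>

lemma averaged_hamiltonian_derivative:
  fixes \<beta> \<mu> :: real
  assumes u: "u \<in> phase_space" and v: "v \<in> phase_space"
  defines "G \<equiv> nls_field (\<mu>\<^sup>2 / 2) (\<mu>\<^sup>2 * (3 * \<beta> / 4)) u"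
  shows "((\<lambda>s. h4 (\<lambda>y. u y + of_real s * v y)
      + of_real (\<mu>\<^sup>2) * flow_average (F4 \<beta>) (\<lambda>y. u y + of_real s * v y))
    has_vector_derivative integral cell (\<lambda>y. G y * cnj (v y) + v y * cnj (G y))) (at 0)"
proof -
  note c = phase_space_continuous[OF u] phase_space_continuous[OF v]
  define D V where "D = dy1 (dy1 u)" and "V = dy1 (dy1 v)"
  \<comment> \<open>\<open>A\<close>, \<open>B\<close>, \<open>C\<close> are the coefficients of 1,
    s, s^2 in the squared modulus of \<open>u + s v\<close>; \<open>p0\<close> to \<open>p4\<close>
    below collect the powers of \<open>s\<close> in the whole Hamiltonian density.\<close>
  define A B C where "A = (\<lambda>y. u y * cnj (u y))" and "B = (\<lambda>y. u y * cnj (v y) + v y * cnj (u y))"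
    and "C = (\<lambda>y. v y * cnj (v y))"
  define m k where "m = complex_of_real (\<mu>\<^sup>2)" and "k = complex_of_real (3 * \<beta> / 8)"
  define p0 where "p0 = (\<lambda>y. A y + m * (- (u y * cnj (D y) + cnj (u y) * D y) / 4 + k * A y ^ 2))"
  define p1 where "p1 = (\<lambda>y. B y + m * (- (u y * cnj (V y) + v y * cnj (D y) + cnj (u y) * V y
    + cnj (v y) * D y) / 4 + k * (2 * A y * B y)))"
  define p2 where "p2 = (\<lambda>y. C y + m * (- (v y * cnj (V y) + cnj (v y) * V y) / 4
    + k * (B y ^ 2 + 2 * A y * C y)))"
  define p3 p4 where "p3 = (\<lambda>y. m * (k * (2 * B y * C y)))" and "p4 = (\<lambda>y. m * (k * C y ^ 2))"
  have cD: "continuous_on UNIV D" "continuous_on UNIV V" using c by (simp_all add: D_def V_def)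
  have cA: "continuous_on UNIV A" "continuous_on UNIV B" "continuous_on UNIV C"
    unfolding A_def B_def C_def by (intro continuous_intros c)+
  have cp: "continuous_on UNIV p0" "continuous_on UNIV p1" "continuous_on UNIV p2"
    "continuous_on UNIV p3" "continuous_on UNIV p4"
    unfolding p0_def p1_def p2_def p3_def p4_def by (intro continuous_intros c cD cA; simp)+
  have H: "h4 (\<lambda>y. u y + of_real s * v y) + of_real (\<mu>\<^sup>2) * flow_average (F4 \<beta>) (\<lambda>y. u y + of_real s * v y)
    = integral cell (\<lambda>y. p0 y + of_real s * p1 y + of_real s ^ 2 * p2 y + of_real s ^ 3 * p3 y
      + of_real s ^ 4 * p4 y)" for s :: real
  proof -
    have w: "(\<lambda>y. u y + of_real s * v y) \<in> phase_space"
      and dw: "dy1 (dy1 (\<lambda>y. u y + of_real s * v y)) = (\<lambda>y. D y + of_real s * V y)"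
      using phase_space_lincomb[OF u v, of 1 "of_real s"] by (simp_all add: D_def V_def)
    define f g where "f = (\<lambda>y. u y + of_real s * v y)" and "g = (\<lambda>y. D y + of_real s * V y)"
    have cf: "continuous_on UNIV f" "continuous_on UNIV g"
      unfolding f_def g_def by (intro continuous_intros c cD)+
    have "h4 f + of_real (\<mu>\<^sup>2) * flow_average (F4 \<beta>) f = integral cell (\<lambda>y. f y * cnj (f y)
        + m * (- (f y * cnj (g y) + cnj (f y) * g y) / 4 + k * (f y * cnj (f y)) ^ 2))"
      unfolding flow_average_F4[OF w[folded f_def]] dw[folded f_def g_def] h4_def m_def k_def
      by (subst integral_add; (intro integrable_cell continuous_intros cf; simp; fail)?) simp
    also have "\<dots> = integral cell (\<lambda>y. p0 y + of_real s * p1 y + of_real s ^ 2 * p2 y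
        + of_real s ^ 3 * p3 y + of_real s ^ 4 * p4 y)"
    proof (rule arg_cong[of _ _ "integral cell"], rule ext)
      fix y
      define r where "r = complex_of_real s"
      have ff: "f y * cnj (f y) = A y + r * B y + r ^ 2 * C y"
        by (simp add: f_def A_def B_def C_def r_def algebra_simps power2_eq_square)
      have fg: "f y * cnj (g y) + cnj (f y) * g y = (u y * cnj (D y) + cnj (u y) * D y)
          + r * (u y * cnj (V y) + v y * cnj (D y) + cnj (u y) * V y + cnj (v y) * D y)
          + r ^ 2 * (v y * cnj (V y) + cnj (v y) * V y)"
        by (simp add: f_def g_def r_def algebra_simps power2_eq_square)
      show "f y * cnj (f y) + m * (- (f y * cnj (g y) + cnj (f y) * g y) / 4 + k * (f y * cnj (f y)) ^ 2)
        = p0 y + of_real s * p1 y + of_real s ^ 2 * p2 y + of_real s ^ 3 * p3 y + of_real s ^ 4 * p4 y"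
        unfolding ff fg p0_def p1_def p2_def p3_def p4_def r_def[symmetric]
        by (simp add: field_simps power2_eq_square power3_eq_cube power4_eq_xxxx)
    qed
    finally show ?thesis unfolding f_def .
  qed
  have cG: "continuous_on UNIV G" unfolding G_def by (rule continuous_nls_field[OF u])
  have "integral cell p1 - integral cell (\<lambda>y. G y * cnj (v y) + v y * cnj (G y))
      = integral cell (\<lambda>y. p1 y - (G y * cnj (v y) + v y * cnj (G y)))"
    by (subst integral_diff) (auto intro!: integrable_cell continuous_intros cp cG c)
  \<comment> \<open>The mass and cubic terms cancel pointwise. What remains is the mismatch between
    derivatives on \<open>u\<close> and on \<open>v\<close>, which vanishes only after
    integration.\<close>
  also have "\<dots> = integral cell (\<lambda>y. m / 4 * ((D y * cnj (v y) - u y * cnj (V y))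
      + (cnj (D y) * v y - cnj (u y) * V y)))"
  proof (rule arg_cong[of _ _ "integral cell"], rule ext)
    fix y
    have G: "G y = u y - m / 2 * D y + 2 * m * k * A y * u y"
      by (simp add: G_def nls_field_def m_def k_def A_def D_def)
    \<comment> \<open>The factors \<open>m\<close>, \<open>k\<close> and \<open>A y\<close> are
      real, so conjugation affects only \<open>u y\<close> and \<open>D y\<close>.\<close>
    have G': "cnj (G y) = cnj (u y) - m / 2 * cnj (D y) + 2 * m * k * A y * cnj (u y)"
      by (simp add: G m_def k_def A_def)
    show "p1 y - (G y * cnj (v y) + v y * cnj (G y)) = m / 4 * ((D y * cnj (v y) - u y * cnj (V y))
      + (cnj (D y) * v y - cnj (u y) * V y))"
      unfolding G' unfolding G p1_def B_def by (simp add: field_simps)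
  qed
  also have "\<dots> = m / 4 * ((integral cell (\<lambda>y. D y * cnj (v y)) - integral cell (\<lambda>y. u y * cnj (V y)))
      + (integral cell (\<lambda>y. cnj (D y) * v y) - integral cell (\<lambda>y. cnj (u y) * V y)))"
    by (simp add: integral_add integral_diff integrable_cell continuous_intros c cD)
  also have "\<dots> = 0"
    using dy1_dy1_symmetric[OF u conjunct1[OF phase_space_cnj[OF v]]]
      dy1_dy1_symmetric[OF conjunct1[OF phase_space_cnj[OF u]] v]
      phase_space_cnj[OF u] phase_space_cnj[OF v] by (simp add: D_def V_def)
  finally show ?thesis
    unfolding H using integral_cell_quartic_has_derivative[OF cp] by simp
qed

section \<open>Periodic bump functions\<close>

text \<open>Away from 0 the function is locally zero or a pure power. At the kink the exponent,
  being at least 2, leaves a positive power of \<open>max 0 h\<close> in the difference quotient,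
  which tends to 0.\<close>

lemma has_real_derivative_max0_power:
  "((\<lambda>x::real. max 0 x ^ (n + 2)) has_real_derivative real (n + 2) * max 0 x ^ (n + 1)) (at x)"
proof (cases x "0::real" rule: linorder_cases)
  case less
  have "((\<lambda>x. 0) has_real_derivative real (n + 2) * max 0 x ^ (n + 1)) (at x)"
    using less by (simp add: max_def)
  then show ?thesis
    by (rule has_field_derivative_transform_within_open[where S = "{..<0}"]) (use less in \<open>auto simp: max_def\<close>)
next
  case greater
  have "((\<lambda>x. x ^ (n + 2)) has_real_derivative real (n + 2) * max 0 x ^ (n + 1)) (at x)"
    using greater DERIV_pow[of "n + 2" x] by (simp add: max_def)
  then show ?thesis
    by (rule has_field_derivative_transform_within_open[where S = "{0<..}"]) (use greater in \<open>auto simp: max_def\<close>)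
next
  case equal
  \<comment> \<open>At \<open>h = 0\<close> both sides are 0, the left one because division by zero
    yields 0.\<close>
  have "(max 0 (0 + h) ^ (n + 2) - max 0 0 ^ (n + 2)) / h = max 0 h ^ (n + 1)" for h :: real
    by (cases "h > 0") (auto simp: max_def)
  moreover have "((\<lambda>h::real. max 0 h ^ (n + 1)) \<longlongrightarrow> max 0 0 ^ (n + 1)) (at 0)"
    by (intro tendsto_intros)
  ultimately show ?thesis
    unfolding equal DERIV_def by simp
qed

lemma abs_minus_two_round_le: "\<bar>t - 2 * of_int (round (t / 2))\<bar> \<le> 1" for t :: real
  using of_int_round_abs_le[of "t / 2"] by linarith

text \<open>Subtracting the nearest even integer brings \<open>t\<close> into [-1, 1] without
  changing the cosine, and the cosine is decreasing on [0, pi].\<close>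

lemma cos_gt_imp_near_even:
  assumes \<delta>: "0 < \<delta>" "\<delta> \<le> 1" and t: "cos (pi * \<delta>) < cos (pi * t)"
  obtains k :: int where "\<bar>t - 2 * of_int k\<bar> < \<delta>"
proof
  define r where "r = t - 2 * of_int (round (t / 2))"
  have r: "\<bar>r\<bar> \<le> 1"
    unfolding r_def by (rule abs_minus_two_round_le)
  have "cos (pi * t) = cos (pi * r)"
  proof -
    have "pi * r = pi * t - 2 * pi * of_int (round (t / 2))" by (simp add: r_def algebra_simps)
    then show ?thesis by (simp add: cos_diff)
  qed
  then have "cos (pi * \<delta>) < cos (pi * \<bar>r\<bar>)"
    using t by (simp add: abs_if)
  then have "\<not> \<delta> \<le> \<bar>r\<bar>"
    using \<delta> r cos_monotone_0_pi_le[of "pi * \<delta>" "pi * \<bar>r\<bar>"] by (auto simp: mult_le_cancel_left1)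
  then show "\<bar>t - 2 * of_int (round (t / 2))\<bar> < \<delta>" by (simp add: r_def)
qed

lemma doubly_periodic_shift:
  fixes R :: "real \<times> real \<Rightarrow> complex" and k l :: int
  assumes "\<And>y1 y2. R (y1 + 2, y2) = R (y1, y2) \<and> R (y1, y2 + 2) = R (y1, y2)"
  shows "R (y1 - 2 * of_int k, y2 - 2 * of_int l) = R (y1, y2)"
proof -
  interpret y1: periodic_fun_simple "\<lambda>x. R (x, y2)" 2 for y2
    by unfold_locales (simp add: assms)
  interpret y2: periodic_fun_simple "\<lambda>y. R (y1, y)" 2 for y1
    by unfold_locales (simp add: assms)
  show ?thesis
    by (simp only: mult.commute[of 2] y1.minus_of_int y2.minus_of_int)
qed

text \<open>The function cos (pi (y - a)) - cos (pi \<delta>) has period 2 and is positive only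
  within \<delta> of a modulo 2. Truncating it at 0 in each variable gives a bump that is periodic
  by construction. The amplitude \<open>z\<close> is free so that its phase can later be matched to
  a given value.\<close>

lemma localised_test_function:
  fixes a1 a2 \<delta> :: real
  assumes \<delta>: "0 < \<delta>" "\<delta> \<le> 1"
  obtains b :: "real \<times> real \<Rightarrow> real" where
    "\<And>z. (\<lambda>y. of_real (b y) * z) \<in> phase_space" "continuous_on UNIV b"
    "\<And>y. 0 \<le> b y" "0 < b (a1, a2)"
    "\<And>y1 y2. b (y1, y2) \<noteq> 0 \<Longrightarrow>
      \<exists>k l :: int. \<bar>y1 - a1 - 2 * of_int k\<bar> < \<delta> \<and> \<bar>y2 - a2 - 2 * of_int l\<bar> < \<delta>"
proof -
  define c where "c = cos (pi * \<delta>)"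
  have c: "c < 1"
    using \<delta> cos_monotone_0_pi[of 0 "pi * \<delta>"] by (simp add: c_def)
  define f where "f = (\<lambda>t. cos (pi * t) - c)"
  \<comment> \<open>The cube makes \<open>b\<close> twice continuously differentiable in the first variable.\<close>
  define b where "b = (\<lambda>(y1, y2). max 0 (f (y1 - a1)) ^ 3 * max 0 (f (y2 - a2)))"
  define d where "d = (\<lambda>(y1, y2). 3 * max 0 (f (y1 - a1)) ^ 2 * (- pi * sin (pi * (y1 - a1)))
    * max 0 (f (y2 - a2)))"
  define e where "e = (\<lambda>(y1, y2). (6 * max 0 (f (y1 - a1)) * (pi * sin (pi * (y1 - a1))) ^ 2
    - 3 * max 0 (f (y1 - a1)) ^ 2 * (pi ^ 2 * cos (pi * (y1 - a1)))) * max 0 (f (y2 - a2)))"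
  have f': "((\<lambda>s. f (s - a1)) has_real_derivative - pi * sin (pi * (y1 - a1))) (at y1)" for y1
    unfolding f_def by (auto intro!: derivative_eq_intros)
  have f3: "((\<lambda>s. max 0 (f (s - a1)) ^ 3) has_real_derivative
      3 * max 0 (f (y1 - a1)) ^ 2 * (- pi * sin (pi * (y1 - a1)))) (at y1)" for y1
    \<comment> \<open>The index stands for the exponent minus 2: here 1 for the cube, below 0 for
      the square.\<close>
    using DERIV_chain2[OF has_real_derivative_max0_power[of 1] f'] by (simp add: numeral_eq_Suc)
  have f2: "((\<lambda>s. max 0 (f (s - a1)) ^ 2) has_real_derivative
      2 * max 0 (f (y1 - a1)) * (- pi * sin (pi * (y1 - a1)))) (at y1)" for y1
    using DERIV_chain2[OF has_real_derivative_max0_power[of 0] f'] by (simp add: numeral_eq_Suc)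
  have fp: "f (x + 2 - a) = f (x - a)" for x a
    using cos_periodic[of "pi * (x - a)"] by (simp add: f_def algebra_simps)
  have bd: "((\<lambda>s. b (s, y2)) has_real_derivative d (y1, y2)) (at y1)" for y1 y2
    unfolding b_def d_def split by (rule DERIV_cmult_right[OF f3])
  have de: "((\<lambda>s. d (s, y2)) has_real_derivative e (y1, y2)) (at y1)" for y1 y2
  proof -
    have "((\<lambda>s. - pi * sin (pi * (s - a1))) has_real_derivative - (pi ^ 2 * cos (pi * (y1 - a1)))) (at y1)"
      by (auto intro!: derivative_eq_intros simp: power2_eq_square)
    from DERIV_cmult_right[OF DERIV_mult[OF DERIV_cmult[OF f2, of 3] this]]
    show ?thesis
      unfolding d_def e_def split by (rule DERIV_cong) (simp add: algebra_simps power2_eq_square)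
  qed
  have cont: "continuous_on UNIV b" "continuous_on UNIV d" "continuous_on UNIV e"
    unfolding b_def d_def e_def f_def split_beta by (intro continuous_intros)+
  show ?thesis
  proof
    fix z
    show "(\<lambda>y. of_real (b y) * z) \<in> phase_space"
    proof (rule conjunct1[OF phase_spaceI[where d = "\<lambda>y. of_real (d y) * z" and e = "\<lambda>y. of_real (e y) * z"]])
      fix y1 y2
      show "of_real (b (y1 + 2, y2)) * z = of_real (b (y1, y2)) * z \<and>
          of_real (b (y1, y2 + 2)) * z = of_real (b (y1, y2)) * z"
        by (simp add: b_def fp)
      show "((\<lambda>s. of_real (b (s, y2)) * z) has_vector_derivative of_real (d (y1, y2)) * z) (at y1)"
        "((\<lambda>s. of_real (d (s, y2)) * z) has_vector_derivative of_real (e (y1, y2)) * z) (at y1)"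
        using bd de by (auto intro!: has_vector_derivative_mult_left has_vector_derivative_of_real
            simp: has_real_derivative_iff_has_vector_derivative)
    qed (intro continuous_intros cont)+
  next
    fix y1 y2 assume "b (y1, y2) \<noteq> 0"
    then have "c < cos (pi * (y1 - a1))" "c < cos (pi * (y2 - a2))"
      by (auto simp: b_def f_def max_def split: if_splits)
    then show "\<exists>k l :: int. \<bar>y1 - a1 - 2 * of_int k\<bar> < \<delta> \<and> \<bar>y2 - a2 - 2 * of_int l\<bar> < \<delta>"
      using cos_gt_imp_near_even[OF \<delta>] unfolding c_def by metis
  next
    show "0 \<le> b y" for y by (simp add: b_def split_beta)
    show "0 < b (a1, a2)" using c by (simp add: b_def f_def)
  qed (rule cont)
qed

section \<open>Nondegeneracy of the pairing with states\<close>

text \<open>The disc around \<open>z\<close> reaching to the origin lies in the open half-plane of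
  numbers at an acute angle to \<open>z\<close>. The polarisation identity makes this
  quantitative.\<close>

lemma Re_cnj_mult_pos:
  assumes "dist w z < cmod z"
  shows "0 < Re (cnj z * w)"
proof -
  have "2 * Re (cnj z * w) = cmod z ^ 2 + cmod w ^ 2 - dist w z ^ 2"
    unfolding dist_norm cmod_power2 by (simp add: power2_eq_square algebra_simps)
  moreover have "dist w z ^ 2 < cmod z ^ 2"
    using assms by (intro power_strict_mono) auto
  moreover have "0 \<le> cmod w ^ 2" by simp
  ultimately show ?thesis by linarith
qed

text \<open>This is the fundamental lemma of the calculus of variations on the torus. If
  \<open>R a\<close> is nonzero, testing with a bump of amplitude \<open>R a\<close> near
  \<open>a\<close> gives a nonnegative continuous integrand that is positive at \<open>a\<close>, so
  its integral cannot vanish.\<close>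

lemma phase_space_nondegenerate:
  fixes R :: "real \<times> real \<Rightarrow> complex"
  assumes R: "continuous_on UNIV R"
    and per: "\<And>y1 y2. R (y1 + 2, y2) = R (y1, y2) \<and> R (y1, y2 + 2) = R (y1, y2)"
    and orth: "\<And>v. v \<in> phase_space \<Longrightarrow> integral cell (\<lambda>y. R y * cnj (v y) + v y * cnj (R y)) = 0"
  shows "R x = 0"
proof -
  \<comment> \<open>The representative of \<open>x\<close> modulo the periods that lies in the cell,
    the domain of integration.\<close>
  define a where "a = (fst x - 2 * of_int (round (fst x / 2)), snd x - 2 * of_int (round (snd x / 2)))"
  have Ra: "R a = R x"
    unfolding a_def by (simp add: doubly_periodic_shift[OF per])
  have a: "a \<in> cell"
    using abs_minus_two_round_le[of "fst x"] abs_minus_two_round_le[of "snd x"]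
    by (simp add: a_def cell_def abs_le_iff)
  have "R a = 0"
  proof (rule ccontr)
    assume nz: "R a \<noteq> 0"
    have "isCont R a" using R by (simp add: continuous_on_eq_continuous_at del: split_paired_All)
    then obtain \<epsilon> where \<epsilon>: "\<epsilon> > 0" "\<And>y. dist y a < \<epsilon> \<Longrightarrow> dist (R y) (R a) < cmod (R a)"
      using nz unfolding continuous_at_eps_delta by (metis zero_less_norm_iff)
    \<comment> \<open>The cap 1 is what the bump construction asks for; half of \<epsilon> makes two
      coordinate distances below \<delta> add up to a distance below \<epsilon>.\<close>
    define \<delta> where "\<delta> = min 1 (\<epsilon> / 2)"
    have \<delta>: "0 < \<delta>" "\<delta> \<le> 1" "2 * \<delta> \<le> \<epsilon>" using \<epsilon> by (auto simp: \<delta>_def)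
    obtain b where b: "\<And>z. (\<lambda>y. of_real (b y) * z) \<in> phase_space" "continuous_on UNIV b"
      "\<And>y. 0 \<le> b y" "0 < b a"
      "\<And>y1 y2. b (y1, y2) \<noteq> 0 \<Longrightarrow>
        \<exists>k l :: int. \<bar>y1 - fst a - 2 * of_int k\<bar> < \<delta> \<and> \<bar>y2 - snd a - 2 * of_int l\<bar> < \<delta>"
      using localised_test_function[OF \<delta>(1,2), of "fst a" "snd a"] by (metis prod.collapse)
    define f where "f = (\<lambda>y. 2 * b y * Re (cnj (R a) * R y))"
    have pos: "0 \<le> f y" for y
    proof (cases "b y = 0")
      case False
      obtain y1 y2 where y: "y = (y1, y2)" by fastforce
      obtain k l :: int where kl: "\<bar>y1 - fst a - 2 * of_int k\<bar> < \<delta>" "\<bar>y2 - snd a - 2 * of_int l\<bar> < \<delta>"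
        using b(5) False y by blast
      \<comment> \<open>The bump may be nonzero near translates of \<open>a\<close> as well;
        \<open>y'\<close> is the translate of \<open>y\<close> close to \<open>a\<close> itself, and
        \<open>R\<close> takes the same value there.\<close>
      define y' where "y' = (y1 - 2 * of_int k, y2 - 2 * of_int l)"
      have "dist y' a \<le> \<bar>fst y' - fst a\<bar> + \<bar>snd y' - snd a\<bar>"
        unfolding dist_prod_def dist_real_def by (intro sqrt_sum_squares_le_sum) simp_all
      also have "\<dots> < \<epsilon>" using kl \<delta> by (simp add: y'_def algebra_simps)
      finally have "0 < Re (cnj (R a) * R y')" using Re_cnj_mult_pos \<epsilon> by blast
      moreover have "R y' = R y" by (simp add: y'_def y doubly_periodic_shift[OF per])
      ultimately show ?thesis using b(3) by (simp add: f_def)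
    qed (simp add: f_def)
    have cf: "continuous_on cell f"
      unfolding f_def by (intro continuous_intros continuous_on_subset[OF R subset_UNIV]
          continuous_on_subset[OF b(2) subset_UNIV])
    have "of_real (integral cell f) = integral cell (\<lambda>y. complex_of_real (f y))"
      using integrable_continuous[of "(-1, -1)" "(1, 1)" f] cf
      by (metis cell_def has_integral_of_real integrable_integral integral_unique)
    also have "\<dots> = integral cell (\<lambda>y. R y * cnj (of_real (b y) * R a) + of_real (b y) * R a * cnj (R y))"
      by (rule arg_cong[of _ _ "integral cell"]) (auto simp: f_def complex_eq_iff algebra_simps)
    also have "\<dots> = 0" using orth[OF b(1)] .
    finally have "integral cell f = 0" by simp
    \<comment> \<open>A nonnegative continuous function with zero integral vanishes on the whole
      closed box, so \<open>a\<close> may lie on the boundary of the cell.\<close>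
    then have "f a = 0"
      using integral_cbox_eq_0_iff[of "(-1, -1)" "(1, 1)" f] cf a pos
      unfolding cell_def by (auto simp: box_eq_empty Basis_prod_def)
    moreover have "Re (cnj (R a) * R a) > 0" using nz by (intro Re_cnj_mult_pos) simp
    ultimately show False using b(4) by (simp add: f_def)
  qed
  then show ?thesis using Ra by simp
qed

section \<open>From Hamilton's equations to the Schroedinger equation\<close>

text \<open>Since \<open>J\<close> is open, the trajectories at a point and at its translate agree
  for all times near \<tau>, hence have the same derivative there. This supplies the periodicity
  that \<open>phase_space_nondegenerate\<close> asks for.\<close>

lemma time_deriv_periodic:
  assumes "open J" "regular_trajectory J \<psi>" "\<tau> \<in> J"
  shows "time_deriv \<psi> \<tau> (y1 + 2, y2) = time_deriv \<psi> \<tau> (y1, y2)"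
    "time_deriv \<psi> \<tau> (y1, y2 + 2) = time_deriv \<psi> \<tau> (y1, y2)"
proof -
  have eqI: "time_deriv \<psi> \<tau> y = time_deriv \<psi> \<tau> z" if "\<And>t. t \<in> J \<Longrightarrow> \<psi> t y = \<psi> t z" for y z
  proof -
    have "(\<lambda>t. \<psi> t z) differentiable (at \<tau>)"
      using assms(2,3) unfolding regular_trajectory_def by blast
    then have "((\<lambda>t. \<psi> t z) has_vector_derivative time_deriv \<psi> \<tau> z) (at \<tau>)"
      unfolding time_deriv_def by (rule vector_derivative_works[THEN iffD1])
    then have "((\<lambda>t. \<psi> t y) has_vector_derivative time_deriv \<psi> \<tau> z) (at \<tau>)"
      by (rule has_vector_derivative_transform_within_open[OF _ assms(1,3)]) (simp add: that)
    then show ?thesis unfolding time_deriv_def[of \<psi> \<tau>] by (rule vector_derivative_at)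
  qed
  have "\<psi> t \<in> phase_space" if "t \<in> J" for t
    using assms(2) that by (simp add: regular_trajectory_def)
  note per = phase_space_periodic[OF this]
  show "time_deriv \<psi> \<tau> (y1 + 2, y2) = time_deriv \<psi> \<tau> (y1, y2)"
    "time_deriv \<psi> \<tau> (y1, y2 + 2) = time_deriv \<psi> \<tau> (y1, y2)"
    by (rule eqI, rule per, assumption)+
qed

text \<open>The second variable enters the field only as a parameter, so the family of
  one-dimensional equations is a single pointwise equation on the plane.\<close>

lemma solves_cubic_nls_iff_nls_field:
  "(\<forall>y2. solves_cubic_nls a b J (\<lambda>\<tau> y1. \<psi> \<tau> (y1, y2))) \<longleftrightarrow>
    (\<forall>\<tau>\<in>J. \<forall>y. - \<i> * time_deriv \<psi> \<tau> y = nls_field a b (\<psi> \<tau>) y)"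
proof -
  have "complex_of_real ((cmod z)\<^sup>2) = z * cnj z" for z
    by (rule complex_norm_square)
  then show ?thesis
    unfolding solves_cubic_nls_def nls_field_def time_deriv_def split_paired_All dy1_apply by auto
qed

theorem corollary4p8:
  fixes \<beta> \<mu> :: real and J :: "real set" and \<psi> :: "real \<Rightarrow> real \<times> real \<Rightarrow> complex"
  assumes "\<beta> > 0" and "\<mu> > 0" and "open J" and "regular_trajectory J \<psi>"
  shows "hamiltonian_motion (\<lambda>u. h4 u + of_real (\<mu>\<^sup>2) * flow_average (F4 \<beta>) u) J \<psi>
    \<longleftrightarrow> (\<forall>y2. solves_cubic_nls (\<mu>\<^sup>2 / 2) (\<mu>\<^sup>2 * (3 * \<beta> / 4)) J (\<lambda>\<tau> y1. \<psi> \<tau> (y1, y2)))"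
proof -
  define G where "G = (\<lambda>\<tau>. nls_field (\<mu>\<^sup>2 / 2) (\<mu>\<^sup>2 * (3 * \<beta> / 4)) (\<psi> \<tau>))"
  define w where "w = (\<lambda>\<tau> y. - \<i> * time_deriv \<psi> \<tau> y)"
  \<comment> \<open>With \<open>w\<close> equal to \<open>- \<i>\<close> times the velocity, the
    symplectic form takes the same shape as the derivative of the Hamiltonian, with \<open>w\<close>
    in place of \<open>G\<close>.\<close>
  have symp: "sympl (time_deriv \<psi> \<tau>) v = integral cell (\<lambda>y. w \<tau> y * cnj (v y) + v y * cnj (w \<tau> y))" for \<tau> v
    unfolding sympl_def w_def by (rule arg_cong[of _ _ "integral cell"]) (auto simp: algebra_simps)
  have "(\<forall>v\<in>phase_space. ((\<lambda>s. h4 (\<lambda>y. \<psi> \<tau> y + of_real s * v y)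
      + of_real (\<mu>\<^sup>2) * flow_average (F4 \<beta>) (\<lambda>y. \<psi> \<tau> y + of_real s * v y))
      has_vector_derivative sympl (time_deriv \<psi> \<tau>) v) (at 0)) \<longleftrightarrow> (\<forall>y. w \<tau> y = G \<tau> y)"
    (is "?motion \<longleftrightarrow> _") if \<tau>: "\<tau> \<in> J" for \<tau>
  proof
    have u: "\<psi> \<tau> \<in> phase_space" and cw: "continuous_on UNIV (w \<tau>)"
      using assms(4) \<tau> unfolding w_def regular_trajectory_def by (auto intro!: continuous_intros)
    have cG: "continuous_on UNIV (G \<tau>)" unfolding G_def by (rule continuous_nls_field[OF u])
    note deriv = averaged_hamiltonian_derivative[OF u, of _ \<mu> \<beta>, folded fun_cong[OF G_def]]
    show "\<forall>y. w \<tau> y = G \<tau> y" if motion: ?motion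
    proof -
      have "w \<tau> y - G \<tau> y = 0" for y
      proof (rule phase_space_nondegenerate[of "\<lambda>y. w \<tau> y - G \<tau> y"])
        fix y1 y2
        show "w \<tau> (y1 + 2, y2) - G \<tau> (y1 + 2, y2) = w \<tau> (y1, y2) - G \<tau> (y1, y2) \<and>
            w \<tau> (y1, y2 + 2) - G \<tau> (y1, y2 + 2) = w \<tau> (y1, y2) - G \<tau> (y1, y2)"
          by (simp add: w_def G_def nls_field_def time_deriv_periodic[OF assms(3,4) \<tau>]
              phase_space_periodic[OF u] phase_space_dy1_periodic[OF u])
      next
        fix v assume v: "v \<in> phase_space"
        \<comment> \<open>Both sides are derivatives at 0 of the same function of \<open>s\<close>:
          one by the equations of motion, the other by the computed variation.\<close>
        have "integral cell (\<lambda>y. w \<tau> y * cnj (v y) + v y * cnj (w \<tau> y))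
            = integral cell (\<lambda>y. G \<tau> y * cnj (v y) + v y * cnj (G \<tau> y))"
          using vector_derivative_unique_at[OF bspec[OF motion v] deriv[OF v]] by (simp add: symp)
        then have "integral cell (\<lambda>y. (w \<tau> y * cnj (v y) + v y * cnj (w \<tau> y))
            - (G \<tau> y * cnj (v y) + v y * cnj (G \<tau> y))) = 0"
          by (subst integral_diff)
            (simp_all add: integrable_cell continuous_intros cw cG phase_space_continuous[OF v])
        then show "integral cell (\<lambda>y. (w \<tau> y - G \<tau> y) * cnj (v y) + v y * cnj (w \<tau> y - G \<tau> y)) = 0"
          by (simp add: algebra_simps)
      qed (intro continuous_intros cw cG)
      then show ?thesis by simp
    qed
    show ?motion if "\<forall>y. w \<tau> y = G \<tau> y"
    proof -
      have "w \<tau> = G \<tau>" using that by blast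
      then show ?thesis unfolding symp by (simp only:) (intro ballI deriv)
    qed
  qed
  then show ?thesis
    unfolding solves_cubic_nls_iff_nls_field hamiltonian_motion_def w_def G_def by blast
qed

end
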